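(* Let $m_1,\ldots,m_k$ be positive integers with sum $M$, and put $L=\prod_{i=1}^{k}\binom{m_1+\cdots+m_i}{m_i}$. There are exactly $L$ distinct families $\mathrm{fam}(\alpha_1),\ldots,\mathrm{fam}(\alpha_L)$ of exact $k$-typed parking functions of order $(m_1,\ldots,m_k)$, and the number of exact $k$-typed parking functions of order $(m_1,\ldots,m_k)$ is $$\sum_{j=1}^{L}F(\alpha_j),$$ where $\alpha_j$ is a representative of the $j$-th family.
   Context: There are $M$ cars, $m_i$ of them of type $i$, and $M$ parking spots in a row. Consider tuples $\alpha=(m_1;P_2,\ldots,P_k)$, where each $P_i=(p^{(i)}_1,\ldots,p^{(i)}_{m_i})$ is an ordered list of nonnegative integers (for $k=1$, $\alpha=(m_1)$). Such an $\alpha$ is an exact $k$-typed parking function (exact $k$-TPF) of order $(m_1,\ldots,m_k)$ if there is an arrangement of the $M$ cars in the $M$ spots, one car per spot, such that for all $2\le i\le k$ and $1\le j\le m_i$ the $j$-th car of type $i$ has exactly $p^{(i)}_j$ cars of types in $\{1,\ldots,i-1\}$ parked before it. An exact $k$-TPF $\beta=(m_1;Q_2,\ldots,Q_k)$ is a parking permutation of $\alpha=(m_1;P_2,\ldots,P_k)$ if for every $i=2,\ldots,k$ the list $Q_i$ is a rearrangement of the list $P_i$. The family $\mathrm{fam}(\alpha)$ is the set of all parking permutations of $\alpha$ (including $\alpha$ itself). For an exact $k$-TPF $\alpha$ of order $(m_1,\ldots,m_k)$, $$F(\alpha)=\prod_{i=1}^{k}\frac{m_i!}{a_{i_0}!\,a_{i_1}!\cdots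 a_{i_{\mu_i}}!},\qquad \mu_i=\sum_{j=1}^{i-1}m_j,$$ where for $i\ge2$ and $0\le j\le\mu_i$, $a_{i_j}$ is the number of entries of $P_i$ equal to $j$, and the factor for $i=1$ is $m_1!/m_1!=1$. *)

theory Defs
  imports Complex_Main "HOL-Library.Multiset"
begin

text \<open>
  A pair \<open>(m, [P\<^sub>2, \<dots>, P\<^sub>k])\<close> is the tuple \<open>(m\<^sub>1; P\<^sub>2, \<dots>, P\<^sub>k)\<close>. Types, cars of a given type and
  parking spots are numbered from 1, whereas positions in Isabelle lists are numbered from 0; hence
  the shifts in the accessors below. The empty list of preferences is the case \<open>k = 1\<close>.
\<close>

type_synonym typed_tuple = "nat \<times> nat list list"

text \<open>The list \<open>P\<^sub>i\<close>, meaningful for \<open>2 \<le> i \<le> k\<close>.\<close>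

definition prefs :: "typed_tuple \<Rightarrow> nat \<Rightarrow> nat list" where
  "prefs \<alpha> i = snd \<alpha> ! (i - 2)"

text \<open>The order \<open>(m\<^sub>1, \<dots>, m\<^sub>k)\<close>; its length is \<open>k\<close>.\<close>

definition tpf_order :: "typed_tuple \<Rightarrow> nat list" where
  "tpf_order \<alpha> = fst \<alpha> # map length (snd \<alpha>)"

text \<open>\<open>num_cars ms i\<close> is \<open>m\<^sub>i\<close>, meaningful for \<open>1 \<le> i \<le> k\<close>.\<close>

definition num_cars :: "nat list \<Rightarrow> nat \<Rightarrow> nat" where
  "num_cars ms i = ms ! (i - 1)"

text \<open>The pair \<open>(i, j)\<close> is the \<open>j\<close>-th car of type \<open>i\<close>.\<close>

definition cars :: "nat list \<Rightarrow> (nat \<times> nat) set" where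
  "cars ms = {(i, j). i \<in> {1..length ms} \<and> j \<in> {1..num_cars ms i}}"

text \<open>\<open>s c\<close> is the spot in which the car \<open>c\<close> is parked.\<close>

definition arrangement :: "nat list \<Rightarrow> (nat \<times> nat \<Rightarrow> nat) \<Rightarrow> bool" where
  "arrangement ms s \<longleftrightarrow> bij_betw s (cars ms) {1..sum_list ms}"

definition exact_TPF :: "typed_tuple \<Rightarrow> bool" where
  "exact_TPF \<alpha> \<longleftrightarrow>
     (\<exists>s. arrangement (tpf_order \<alpha>) s \<and>
       (\<forall>i\<in>{2..length (tpf_order \<alpha>)}. \<forall>j\<in>{1..num_cars (tpf_order \<alpha>) i}.
          card {c \<in> cars (tpf_order \<alpha>). fst c < i \<and> s c < s (i, j)} = prefs \<alpha> i ! (j - 1)))"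

definition exact_TPFs :: "nat list \<Rightarrow> typed_tuple set" where
  "exact_TPFs ms = {\<alpha>. exact_TPF \<alpha> \<and> tpf_order \<alpha> = ms}"

definition parking_permutation :: "typed_tuple \<Rightarrow> typed_tuple \<Rightarrow> bool" where
  "parking_permutation \<beta> \<alpha> \<longleftrightarrow>
     exact_TPF \<beta> \<and> fst \<beta> = fst \<alpha> \<and> length (snd \<beta>) = length (snd \<alpha>) \<and>
     (\<forall>i\<in>{2..length (tpf_order \<alpha>)}. mset (prefs \<beta> i) = mset (prefs \<alpha> i))"

definition fam :: "typed_tuple \<Rightarrow> typed_tuple set" where
  "fam \<alpha> = {\<beta>. parking_permutation \<beta> \<alpha>}"

text \<open>The number \<open>\<mu>\<^sub>i\<close> of cars of types \<open>1, \<dots>, i - 1\<close>.\<close>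

definition mu :: "nat list \<Rightarrow> nat \<Rightarrow> nat" where
  "mu ms i = (\<Sum>j=1..<i. num_cars ms j)"

text \<open>The entry count \<open>a\<^bsub>i_j\<^esub>\<close> is \<open>count_list (prefs \<alpha> i) j\<close>; the denominator for \<open>i = 1\<close>, where there
  is no list \<open>P\<^sub>1\<close>, is \<open>m\<^sub>1!\<close> by convention.\<close>

definition F :: "typed_tuple \<Rightarrow> real" where
  "F \<alpha> = (\<Prod>i=1..length (tpf_order \<alpha>).
     fact (num_cars (tpf_order \<alpha>) i) /
       (if i = 1 then fact (num_cars (tpf_order \<alpha>) 1)
        else (\<Prod>j=0..mu (tpf_order \<alpha>) i. fact (count_list (prefs \<alpha> i) j))))"

end

theory Submission
  imports Defs "HOL-Library.FuncSet" "HOL-Combinatorics.Multiset_Permutations"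
begin

text \<open>
  The whole theorem rests on one fact: a tuple of order \<open>(m\<^sub>1, \<dots>, m\<^sub>k)\<close> is an exact typed parking
  function exactly when each entry of each \<open>P\<^sub>i\<close> lies in \<open>{0..\<mu>\<^sub>i}\<close> (lemma \<open>exact_TPFs_eq\<close>). The bound
  is necessary because only \<open>\<mu>\<^sub>i\<close> cars have a smaller type. For sufficiency, park the cars type by
  type. Once the cars of types below \<open>i\<close> stand in a row, a car of type \<open>i\<close> wanting \<open>p \<le> \<mu>\<^sub>i\<close> of them
  before it is inserted into the gap behind the \<open>p\<close>-th one; cars of type \<open>i\<close> sharing a gap may stand
  in any order, and inserting cars never changes the relative order of those already parked, so
  the requirements of the smaller types stay fulfilled (lemmas \<open>insert_into_row\<close> and
  \<open>arrangement_exists\<close>).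

  Hence the lists \<open>P\<^sub>i\<close> can be chosen independently of one another, and so can their rearrangements.
  A family is the choice, for each \<open>i \<ge> 2\<close>, of a multiset of \<open>m\<^sub>i\<close> elements of \<open>{0..\<mu>\<^sub>i}\<close>, and there
  are \<open>\<mu>\<^sub>i + m\<^sub>i\<close> choose \<open>m\<^sub>i\<close> of these; the factor of \<open>L\<close> at \<open>i = 1\<close> is 1. The size of
  \<open>fam \<alpha>\<close> is the product of the numbers of orderings of these multisets, which are the multinomial
  coefficients in \<open>F \<alpha>\<close>. The families partition the set of exact typed parking functions, so adding
  up their sizes counts that set.
\<close>

section \<open>Arranging the cars\<close>

lemma ranking_exists:
  fixes key :: "'a \<Rightarrow> nat"
  assumes "finite A" "inj_on key A"
  shows "\<exists>s. bij_betw s A {1..card A} \<and> (\<forall>a\<in>A. \<forall>b\<in>A. s a < s b \<longleftrightarrow> key a < key b)"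
proof -
  define s where "s a = card {b \<in> A. key b \<le> key a}" for a
  have less: "s a < s b" if "b \<in> A" "key a < key b" for a b
  proof -
    have "{c \<in> A. key c \<le> key a} \<subseteq> {c \<in> A. key c \<le> key b}" using that by auto
    moreover have "b \<in> {c \<in> A. key c \<le> key b} - {c \<in> A. key c \<le> key a}" using that by auto
    ultimately have "{c \<in> A. key c \<le> key a} \<subset> {c \<in> A. key c \<le> key b}" by blast
    then show ?thesis unfolding s_def using assms(1) by (intro psubset_card_mono) auto
  qed
  have le: "s a \<le> s b" if "key a \<le> key b" for a b
    unfolding s_def using assms(1) that by (intro card_mono) auto
  have order: "s a < s b \<longleftrightarrow> key a < key b" if "a \<in> A" "b \<in> A" for a b
    using less[of b a] le[of b a] that by (meson leD leI)
  have inj: "inj_on s A"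
    using assms(2) order by (metis inj_on_def less_irrefl nat_neq_iff)
  have "s a \<in> {1..card A}" if "a \<in> A" for a
  proof -
    have "s a \<noteq> 0" using assms(1) that by (auto simp: s_def)
    moreover have "s a \<le> card A"
      unfolding s_def using assms(1) by (intro card_mono) auto
    ultimately show ?thesis by simp
  qed
  then have "s ` A = {1..card A}"
    by (intro card_subset_eq) (auto simp: card_image inj)
  then show ?thesis using inj order by (auto simp: bij_betw_def)
qed

text \<open>
  Stretch the row until every gap has room for all the new elements, place each of them in its gap,
  and renumber the positions from left to right. Neither step changes the order of the old elements.
\<close>

lemma insert_into_row:
  fixes s :: "'a \<Rightarrow> nat"
  assumes "finite C" "finite D" "C \<inter> D = {}"
    and s: "bij_betw s C {1..card C}"
    and p: "\<forall>d\<in>D. p d \<le> card C"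
  shows "\<exists>t. bij_betw t (C \<union> D) {1..card (C \<union> D)} \<and>
    (\<forall>a\<in>C. \<forall>b\<in>C. t a < t b \<longleftrightarrow> s a < s b) \<and>
    (\<forall>d\<in>D. card {c \<in> C. t c < t d} = p d)"
proof -
  obtain e where e: "bij_betw e D {0..<card D}"
    using ex_bij_betw_finite_nat[OF assms(2)] by blast
  then have e_less: "e d < card D" if "d \<in> D" for d
    using that by (auto simp: bij_betw_def)
  define n where "n = Suc (card D)"
  (* Old elements sit at multiples of n; the new ones of gap p, told apart by e, lie strictly
     between p * n and (p + 1) * n. *)
  define key where "key x = (if x \<in> C then s x * n else p x * n + Suc (e x))" for x
  have n: "0 < n" by (simp add: n_def)
  have keyC: "key c = s c * n" if "c \<in> C" for c using that by (simp add: key_def)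
  have keyD: "key d = p d * n + Suc (e d)" "Suc (e d) < n" if "d \<in> D" for d
    using that assms(3) e_less[OF that] by (auto simp: key_def n_def)
  have modC: "key c mod n = 0" if "c \<in> C" for c using keyC[OF that] by simp
  have modD: "key d mod n = Suc (e d)" if "d \<in> D" for d using keyD[OF that] by simp
  have "x = y" if xy: "x \<in> C \<union> D" "y \<in> C \<union> D" and eq: "key x = key y" for x y
  proof -
    consider "x \<in> C" "y \<in> C" | "x \<in> D" "y \<in> D" | "x \<in> C" "y \<in> D" | "x \<in> D" "y \<in> C"
      using xy by blast
    then show ?thesis
    proof cases
      case 1
      then have "s x = s y" using eq n by (simp add: keyC)
      then show ?thesis using 1 s by (auto simp: bij_betw_def inj_on_def)
    next
      case 2
      then have "e x = e y" using eq modD by (metis Suc_inject)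
      then show ?thesis using 2 e by (auto simp: bij_betw_def inj_on_def)
    qed (use eq modC modD in force)+
  qed
  then have "inj_on key (C \<union> D)" by (rule inj_onI)
  then obtain t where t: "bij_betw t (C \<union> D) {1..card (C \<union> D)}"
    and order: "\<And>a b. a \<in> C \<union> D \<Longrightarrow> b \<in> C \<union> D \<Longrightarrow> t a < t b \<longleftrightarrow> key a < key b"
    using ranking_exists[of "C \<union> D" key] assms(1,2) by auto
  have "t a < t b \<longleftrightarrow> s a < s b" if "a \<in> C" "b \<in> C" for a b
    using that n by (simp add: order keyC)
  moreover have "card {c \<in> C. t c < t d} = p d" if d: "d \<in> D" for d
  proof -
    have "t c < t d \<longleftrightarrow> s c \<le> p d" if c: "c \<in> C" for c
    proof
      assume "s c \<le> p d"
      then have "s c * n \<le> p d * n" by (rule mult_le_mono1)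
      then have "key c < key d" unfolding keyC[OF c] keyD(1)[OF d] by linarith
      then show "t c < t d" using c d by (simp add: order)
    next
      assume "t c < t d"
      then have "s c * n < p d * n + Suc (e d)" using c d by (simp add: order keyC keyD(1))
      also have "\<dots> < Suc (p d) * n" using keyD(2)[OF d] by simp
      finally have "s c * n < Suc (p d) * n" .
      then show "s c \<le> p d" by (metis less_Suc_eq_le mult_less_cancel2)
    qed
    then have "{c \<in> C. t c < t d} = {c \<in> C. s c \<in> {1..p d}}"
      using s by (auto simp: bij_betw_def)
    moreover have "bij_betw s {c \<in> C. s c \<in> {1..p d}} {1..p d}"
    proof (rule bij_betw_subset[OF s])
      have "{1..p d} \<subseteq> s ` C" using s p[rule_format, OF d] by (auto simp: bij_betw_def)
      then show "s ` {c \<in> C. s c \<in> {1..p d}} = {1..p d}" by blast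
    qed blast
    ultimately show ?thesis by (simp add: bij_betw_same_card)
  qed
  ultimately show ?thesis using t by blast
qed

lemma card_cars_below:
  assumes "i \<le> Suc (length ms)"
  shows "finite {c \<in> cars ms. fst c < i}" "card {c \<in> cars ms. fst c < i} = mu ms i"
proof -
  have "{c \<in> cars ms. fst c < i} = Sigma {1..<i} (\<lambda>l. {1..num_cars ms l})"
    using assms by (auto simp: cars_def)
  then show "finite {c \<in> cars ms. fst c < i}" "card {c \<in> cars ms. fst c < i} = mu ms i"
    by (simp_all add: mu_def)
qed

lemma card_cars: "finite (cars ms)" "card (cars ms) = mu ms (Suc (length ms))"
proof -
  have "cars ms = {c \<in> cars ms. fst c < Suc (length ms)}" by (auto simp: cars_def)
  then show "finite (cars ms)" "card (cars ms) = mu ms (Suc (length ms))"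
    using card_cars_below[of "Suc (length ms)" ms] by simp_all
qed

lemma mu_all: "mu ms (Suc (length ms)) = sum_list ms"
proof -
  have "mu ms (Suc (length ms)) = (\<Sum>i = 0..<length ms. num_cars ms (Suc i))"
    unfolding mu_def by (subst sum.shift_bounds_Suc_ivl[symmetric]) simp
  then show ?thesis by (simp add: num_cars_def sum_list_sum_nth)
qed

lemma num_cars_append: "i \<le> length ms \<Longrightarrow> 1 \<le> i \<Longrightarrow> num_cars (ms @ [m]) i = num_cars ms i"
  by (auto simp: num_cars_def nth_append)

lemma mu_append: "i \<le> Suc (length ms) \<Longrightarrow> mu (ms @ [m]) i = mu ms i"
  by (auto simp: mu_def num_cars_append intro!: sum.cong)

lemma cars_append: "cars (ms @ [m]) = cars ms \<union> Pair (Suc (length ms)) ` {1..m}"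
proof (rule set_eqI)
  fix c show "c \<in> cars (ms @ [m]) \<longleftrightarrow> c \<in> cars ms \<union> Pair (Suc (length ms)) ` {1..m}"
    by (cases c) (auto simp: cars_def num_cars_def nth_append)
qed

text \<open>
  Type 1 is included to make the induction uniform: every type is inserted into the row of the
  types before it. For type 1 that row is empty and the bound \<open>mu ms 1 = 0\<close> forces \<open>p 1 j = 0\<close>.
\<close>

lemma arrangement_exists:
  fixes p :: "nat \<Rightarrow> nat \<Rightarrow> nat"
  assumes "\<forall>i\<in>{1..length ms}. \<forall>j\<in>{1..num_cars ms i}. p i j \<le> mu ms i"
  shows "\<exists>s. arrangement ms s \<and> (\<forall>i\<in>{1..length ms}. \<forall>j\<in>{1..num_cars ms i}.
    card {c \<in> cars ms. fst c < i \<and> s c < s (i, j)} = p i j)"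
  using assms
proof (induction ms rule: rev_induct)
  case Nil
  show ?case by (simp add: arrangement_def cars_def bij_betw_def)
next
  case (snoc m ms)
  let ?n = "Suc (length ms)" and ?D = "Pair (Suc (length ms)) ` {1..m}"
  have "\<forall>i\<in>{1..length ms}. \<forall>j\<in>{1..num_cars ms i}. p i j \<le> mu ms i"
  proof (intro ballI)
    fix i j assume "i \<in> {1..length ms}" "j \<in> {1..num_cars ms i}"
    then show "p i j \<le> mu ms i"
      using snoc.prems[rule_format, of i j] by (simp add: num_cars_append mu_append)
  qed
  from snoc.IH[OF this] obtain s where s: "bij_betw s (cars ms) {1..card (cars ms)}"
    and count: "\<And>i j. i \<in> {1..length ms} \<Longrightarrow> j \<in> {1..num_cars ms i} \<Longrightarrow>
      card {c \<in> cars ms. fst c < i \<and> s c < s (i, j)} = p i j"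
    by (auto simp: arrangement_def card_cars mu_all)
  have disj: "cars ms \<inter> ?D = {}" by (auto simp: cars_def)
  have new: "num_cars (ms @ [m]) ?n = m" by (simp add: num_cars_def)
  have fin: "finite ?D" by simp
  have bound: "\<forall>d\<in>?D. case_prod p d \<le> card (cars ms)"
  proof
    fix d assume "d \<in> ?D"
    then obtain j where "d = (?n, j)" "j \<in> {1..m}" by blast
    then show "case_prod p d \<le> card (cars ms)"
      using snoc.prems[rule_format, of ?n j] by (simp add: new mu_append card_cars)
  qed
  from insert_into_row[OF card_cars(1) fin disj s bound]
  obtain t where t: "bij_betw t (cars ms \<union> ?D) {1..card (cars ms \<union> ?D)}"
    and old: "\<forall>a\<in>cars ms. \<forall>b\<in>cars ms. t a < t b \<longleftrightarrow> s a < s b"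
    and gap: "\<forall>d\<in>?D. card {c \<in> cars ms. t c < t d} = case_prod p d"
    by blast
  have "arrangement (ms @ [m]) t"
    using t unfolding arrangement_def cars_append[symmetric]
    by (simp add: card_cars mu_all del: sum_list_append length_append)
  moreover have "card {c \<in> cars (ms @ [m]). fst c < i \<and> t c < t (i, j)} = p i j"
    if ij: "i \<in> {1..length (ms @ [m])}" "j \<in> {1..num_cars (ms @ [m]) i}" for i j
  proof (cases "i = ?n")
    case True
    then have j: "j \<in> {1..m}" using ij new by simp
    have "{c \<in> cars (ms @ [m]). fst c < i \<and> t c < t (i, j)} = {c \<in> cars ms. t c < t (i, j)}"
      using True by (auto simp: cars_append) (auto simp: cars_def)
    then show ?thesis using gap[rule_format, of "(i, j)"] j True by simp
  next
    case False
    then have i: "i \<in> {1..length ms}" using ij by simp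
    then have j: "j \<in> {1..num_cars ms i}" using ij by (simp add: num_cars_append)
    have car: "(i, j) \<in> cars ms" using i j by (simp add: cars_def)
    have "{c \<in> cars (ms @ [m]). fst c < i \<and> t c < t (i, j)}
        = {c \<in> cars ms. fst c < i \<and> s c < s (i, j)}"
      using i old[rule_format, OF _ car] by (auto simp: cars_append)
    then show ?thesis using count[OF i j] by simp
  qed
  ultimately show ?case by blast
qed

section \<open>Typed tuples with independently chosen lists\<close>

definition tuples :: "nat \<Rightarrow> nat \<Rightarrow> (nat \<Rightarrow> nat list set) \<Rightarrow> typed_tuple set" where
  "tuples k m W = {\<alpha>. fst \<alpha> = m \<and> Suc (length (snd \<alpha>)) = k \<and> (\<forall>i\<in>{2..k}. prefs \<alpha> i \<in> W i)}"

text \<open>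
  With \<open>h = mset\<close> this is the label of a family, the choice of one multiset per type; with \<open>h = id\<close>
  it presents a tuple as an element of a product of sets, whose size is known.
\<close>

definition profile :: "nat \<Rightarrow> (nat list \<Rightarrow> 'a) \<Rightarrow> typed_tuple \<Rightarrow> nat \<Rightarrow> 'a" where
  "profile k h \<alpha> = (\<lambda>i\<in>{2..k}. h (prefs \<alpha> i))"

lemma prefs_tuple: "i \<in> {2..k} \<Longrightarrow> prefs (m, map f [2..<Suc k]) i = f i"
proof -
  assume i: "i \<in> {2..k}"
  then have "[2..<Suc k] ! (i - 2) = 2 + (i - 2)" by (intro nth_upt) auto
  also have "\<dots> = i" using i by (intro le_add_diff_inverse) simp
  finally have "[2..<Suc k] ! (i - 2) = i" .
  then show ?thesis using i by (auto simp: prefs_def simp del: upt_Suc nth_upt)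
qed

lemma tuple_cong:
  assumes "fst \<alpha> = fst \<beta>" "Suc (length (snd \<alpha>)) = k" "Suc (length (snd \<beta>)) = k"
    and "\<And>i. i \<in> {2..k} \<Longrightarrow> prefs \<alpha> i = prefs \<beta> i"
  shows "\<alpha> = \<beta>"
proof (rule prod_eqI)
  show "snd \<alpha> = snd \<beta>"
  proof (rule nth_equalityI)
    fix l assume "l < length (snd \<alpha>)"
    then show "snd \<alpha> ! l = snd \<beta> ! l"
      using assms(2) assms(4)[of "l + 2"] by (simp add: prefs_def)
  qed (use assms in simp)
qed (use assms in simp)

lemma profile_image:
  assumes "k \<ge> 1"
  shows "profile k h ` tuples k m W = PiE {2..k} (\<lambda>i. h ` W i)"
proof
  show "profile k h ` tuples k m W \<subseteq> PiE {2..k} (\<lambda>i. h ` W i)"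
    by (auto simp: profile_def tuples_def)
  show "PiE {2..k} (\<lambda>i. h ` W i) \<subseteq> profile k h ` tuples k m W"
  proof
    fix g assume g: "g \<in> PiE {2..k} (\<lambda>i. h ` W i)"
    then have "\<forall>i\<in>{2..k}. \<exists>w\<in>W i. g i = h w" by (auto dest: PiE_mem)
    then obtain f where f: "\<forall>i\<in>{2..k}. f i \<in> W i \<and> g i = h (f i)" by metis
    let ?\<alpha> = "(m, map f [2..<Suc k])"
    have "?\<alpha> \<in> tuples k m W"
      using f assms by (simp add: tuples_def prefs_tuple del: upt_Suc)
    moreover have "profile k h ?\<alpha> = g"
    proof
      fix i show "profile k h ?\<alpha> i = g i"
      proof (cases "i \<in> {2..k}")
        case True
        then have "profile k h ?\<alpha> i = h (f i)"
          unfolding profile_def restrict_apply'[OF True] prefs_tuple[OF True] by simp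
        then show ?thesis using f True by metis
      next
        case False
        then show ?thesis using PiE_arb[OF g False] by (simp only: profile_def restrict_def if_False)
      qed
    qed
    ultimately show "g \<in> profile k h ` tuples k m W" by blast
  qed
qed

lemma card_tuples:
  assumes "k \<ge> 1"
  shows "card (tuples k m W) = (\<Prod>i=2..k. card (W i))"
proof -
  have "inj_on (profile k id) (tuples k m W)"
  proof (rule inj_onI)
    fix \<alpha> \<beta> assume *: "\<alpha> \<in> tuples k m W" "\<beta> \<in> tuples k m W"
      and eq: "profile k id \<alpha> = profile k id \<beta>"
    have "prefs \<alpha> i = prefs \<beta> i" if "i \<in> {2..k}" for i
      using fun_cong[OF eq, of i] that by (simp add: profile_def)
    then show "\<alpha> = \<beta>" using * by (intro tuple_cong[of \<alpha> \<beta> k]) (auto simp: tuples_def)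
  qed
  then have "card (tuples k m W) = card (profile k id ` tuples k m W)"
    by (simp add: card_image)
  also have "\<dots> = (\<Prod>i=2..k. card (W i))"
    using assms by (simp add: profile_image card_PiE)
  finally show ?thesis .
qed

section \<open>Exact typed parking functions and their families\<close>

lemma tpf_order_eq_iff:
  assumes "ms \<noteq> []"
  shows "tpf_order \<alpha> = ms \<longleftrightarrow> fst \<alpha> = hd ms \<and> Suc (length (snd \<alpha>)) = length ms \<and>
    (\<forall>i\<in>{2..length ms}. length (prefs \<alpha> i) = num_cars ms i)"
proof -
  obtain m ns where ms: "ms = m # ns" using assms by (cases ms) auto
  have shift: "(\<forall>i\<in>{2..Suc n}. P i) \<longleftrightarrow> (\<forall>l<n. P (l + 2))" for n and P :: "nat \<Rightarrow> bool"
  proof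
    assume *: "\<forall>l<n. P (l + 2)"
    show "\<forall>i\<in>{2..Suc n}. P i"
    proof
      fix i assume "i \<in> {2..Suc n}"
      then have "i - 2 < n" "i - 2 + 2 = i" by auto
      then show "P i" using * by metis
    qed
  qed auto
  have "tpf_order \<alpha> = ms \<longleftrightarrow> fst \<alpha> = m \<and> map length (snd \<alpha>) = ns"
    by (simp add: ms tpf_order_def)
  also have "map length (snd \<alpha>) = ns \<longleftrightarrow> length (snd \<alpha>) = length ns \<and>
      (\<forall>l<length ns. length (snd \<alpha> ! l) = ns ! l)"
    by (subst list_eq_iff_nth_eq) (simp cong: conj_cong)
  finally show ?thesis
    unfolding ms length_Cons shift by (simp add: prefs_def num_cars_def)
qed

definition lists_below :: "nat list \<Rightarrow> nat \<Rightarrow> nat list set" where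
  "lists_below ms i = {xs. set xs \<subseteq> {0..mu ms i} \<and> length xs = num_cars ms i}"

text \<open>
  A car of type \<open>i\<close> can have at most \<open>\<mu>\<^sub>i\<close> cars of smaller types before it, and every demand within
  this bound can be met by the insertion argument.
\<close>

lemma exact_TPFs_eq:
  assumes "ms \<noteq> []"
  shows "exact_TPFs ms = tuples (length ms) (hd ms) (lists_below ms)"
proof (intro set_eqI iffI)
  fix \<alpha> assume "\<alpha> \<in> exact_TPFs ms"
  then have order: "tpf_order \<alpha> = ms" and "exact_TPF \<alpha>" by (auto simp: exact_TPFs_def)
  then obtain s :: "nat \<times> nat \<Rightarrow> nat" where count: "\<forall>i\<in>{2..length ms}. \<forall>j\<in>{1..num_cars ms i}.
      card {c \<in> cars ms. fst c < i \<and> s c < s (i, j)} = prefs \<alpha> i ! (j - 1)"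
    unfolding exact_TPF_def order by blast
  note len = order[unfolded tpf_order_eq_iff[OF assms]]
  have "set (prefs \<alpha> i) \<subseteq> {0..mu ms i}" if i: "i \<in> {2..length ms}" for i
  proof
    fix x assume "x \<in> set (prefs \<alpha> i)"
    then obtain l where l: "l < num_cars ms i" "x = prefs \<alpha> i ! l"
      using len i by (auto simp: in_set_conv_nth)
    have "x = card {c \<in> cars ms. fst c < i \<and> s c < s (i, Suc l)}"
      using count[rule_format, OF i, of "Suc l"] l by simp
    also have "\<dots> \<le> card {c \<in> cars ms. fst c < i}"
      using i by (intro card_mono card_cars_below) auto
    also have "\<dots> = mu ms i" using i by (intro card_cars_below) auto
    finally show "x \<in> {0..mu ms i}" by simp
  qed
  then show "\<alpha> \<in> tuples (length ms) (hd ms) (lists_below ms)"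
    using len by (auto simp: tuples_def lists_below_def)
next
  fix \<alpha> assume \<alpha>: "\<alpha> \<in> tuples (length ms) (hd ms) (lists_below ms)"
  then have order: "tpf_order \<alpha> = ms"
    using assms by (simp add: tuples_def lists_below_def tpf_order_eq_iff)
  define p where "p i j = (if i = 1 then 0 else prefs \<alpha> i ! (j - 1))" for i j :: nat
  have "p i j \<le> mu ms i" if "i \<in> {1..length ms}" "j \<in> {1..num_cars ms i}" for i j
  proof (cases "i = 1")
    case False
    then have "prefs \<alpha> i \<in> lists_below ms i" using \<alpha> that by (auto simp: tuples_def)
    then have "set (prefs \<alpha> i) \<subseteq> {0..mu ms i}" "j - 1 < length (prefs \<alpha> i)"
      using that by (auto simp: lists_below_def)
    then have "prefs \<alpha> i ! (j - 1) \<in> {0..mu ms i}" by (meson nth_mem subsetD)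
    then show ?thesis using False by (simp add: p_def)
  qed (simp add: p_def)
  then obtain s where "arrangement ms s" and count: "\<forall>i\<in>{1..length ms}. \<forall>j\<in>{1..num_cars ms i}.
      card {c \<in> cars ms. fst c < i \<and> s c < s (i, j)} = p i j"
    using arrangement_exists[of ms p] by blast
  moreover have "card {c \<in> cars ms. fst c < i \<and> s c < s (i, j)} = prefs \<alpha> i ! (j - 1)"
    if "i \<in> {2..length ms}" "j \<in> {1..num_cars ms i}" for i j
    using count[rule_format, of i j] that by (simp add: p_def)
  ultimately show "\<alpha> \<in> exact_TPFs ms"
    using order by (auto simp: exact_TPFs_def exact_TPF_def)
qed

text \<open>
  Rearranging the lists keeps their entries within the bounds, so every tuple of rearrangements is
  again an exact typed parking function.
\<close>

lemma fam_eq: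
  assumes "ms \<noteq> []" "\<alpha> \<in> exact_TPFs ms"
  shows "fam \<alpha> = tuples (length ms) (hd ms) (\<lambda>i. permutations_of_multiset (mset (prefs \<alpha> i)))"
    (is "_ = ?T")
proof -
  have \<alpha>: "\<alpha> \<in> tuples (length ms) (hd ms) (lists_below ms)"
    using assms exact_TPFs_eq by simp
  have order: "tpf_order \<alpha> = ms" using assms(2) by (simp add: exact_TPFs_def)
  have "?T \<subseteq> exact_TPFs ms"
  proof
    fix \<beta> assume \<beta>: "\<beta> \<in> ?T"
    have "prefs \<beta> i \<in> lists_below ms i" if i: "i \<in> {2..length ms}" for i
    proof -
      have "mset (prefs \<beta> i) = mset (prefs \<alpha> i)"
        using \<beta> i by (auto simp: tuples_def permutations_of_multiset_def)
      moreover have "prefs \<alpha> i \<in> lists_below ms i" using \<alpha> i by (auto simp: tuples_def)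
      ultimately show ?thesis
        unfolding lists_below_def by (metis (mono_tags, lifting) mem_Collect_eq mset_eq_setD size_mset)
    qed
    then show "\<beta> \<in> exact_TPFs ms"
      using \<beta> unfolding exact_TPFs_eq[OF assms(1)] by (auto simp: tuples_def)
  qed
  then have exact: "\<beta> \<in> ?T \<Longrightarrow> exact_TPF \<beta>" for \<beta> by (auto simp: exact_TPFs_def)
  have "parking_permutation \<beta> \<alpha> \<longleftrightarrow> \<beta> \<in> ?T" for \<beta>
    using \<alpha> exact[of \<beta>]
    by (auto simp: parking_permutation_def order tuples_def permutations_of_multiset_def)
  then show ?thesis by (auto simp: fam_def)
qed

lemma fam_eq_same_profile:
  assumes "ms \<noteq> []" "\<alpha> \<in> exact_TPFs ms"
  shows "fam \<alpha> = {\<beta> \<in> exact_TPFs ms. profile (length ms) mset \<beta> = profile (length ms) mset \<alpha>}"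
proof -
  have \<alpha>: "fst \<alpha> = hd ms" "Suc (length (snd \<alpha>)) = length ms" "tpf_order \<alpha> = ms"
    using assms(2) tpf_order_eq_iff[OF assms(1)] by (auto simp: exact_TPFs_def)
  have ext: "profile (length ms) mset \<beta> = profile (length ms) mset \<alpha> \<longleftrightarrow>
      (\<forall>i\<in>{2..length ms}. mset (prefs \<beta> i) = mset (prefs \<alpha> i))" for \<beta>
    unfolding profile_def by (metis (no_types, lifting) restrict_apply' restrict_ext)
  show ?thesis
  proof (intro set_eqI iffI)
    fix \<beta> assume "\<beta> \<in> fam \<alpha>"
    then have \<beta>: "exact_TPF \<beta>" "fst \<beta> = fst \<alpha>" "length (snd \<beta>) = length (snd \<alpha>)"
        "\<forall>i\<in>{2..length ms}. mset (prefs \<beta> i) = mset (prefs \<alpha> i)"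
      by (auto simp: fam_def parking_permutation_def \<alpha>)
    then have "\<forall>i\<in>{2..length ms}. length (prefs \<beta> i) = num_cars ms i"
      using \<alpha>(3) unfolding tpf_order_eq_iff[OF assms(1)] by (metis size_mset)
    then have "tpf_order \<beta> = ms"
      using \<alpha> \<beta> unfolding tpf_order_eq_iff[OF assms(1)] by simp
    then show "\<beta> \<in> {\<beta> \<in> exact_TPFs ms. profile (length ms) mset \<beta> = profile (length ms) mset \<alpha>}"
      using \<beta> ext by (simp add: exact_TPFs_def)
  next
    fix \<beta> assume "\<beta> \<in> {\<beta> \<in> exact_TPFs ms. profile (length ms) mset \<beta> = profile (length ms) mset \<alpha>}"
    then show "\<beta> \<in> fam \<alpha>"
      using \<alpha>(1,2) ext tpf_order_eq_iff[OF assms(1)]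
      by (simp add: fam_def parking_permutation_def exact_TPFs_def \<alpha>(3))
  qed
qed

lemma mset_lists_below:
  "mset ` lists_below ms i = multisets_of_size {0..mu ms i} (num_cars ms i)"
proof
  show "multisets_of_size {0..mu ms i} (num_cars ms i) \<subseteq> mset ` lists_below ms i"
  proof
    fix X assume X: "X \<in> multisets_of_size {0..mu ms i} (num_cars ms i)"
    obtain xs where "X = mset xs" by (metis ex_mset)
    with X show "X \<in> mset ` lists_below ms i"
      by (auto simp: multisets_of_size_def lists_below_def)
  qed
qed (auto simp: multisets_of_size_def lists_below_def)

text \<open>Families correspond to profiles of multisets, which form a product of independent choices.\<close>

lemma card_families:
  assumes "ms \<noteq> []"
  shows "card (fam ` exact_TPFs ms) = (\<Prod>i=2..length ms. (mu ms i + num_cars ms i) choose num_cars ms i)"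
proof -
  let ?X = "exact_TPFs ms" and ?f = "profile (length ms) mset"
  have k: "1 \<le> length ms" using assms by (cases ms) auto
  have "fam ` ?X = (\<lambda>v. {\<beta> \<in> ?X. ?f \<beta> = v}) ` ?f ` ?X"
    by (simp add: image_image fam_eq_same_profile[OF assms] cong: image_cong)
  moreover have "inj_on (\<lambda>v. {\<beta> \<in> ?X. ?f \<beta> = v}) (?f ` ?X)"
    by (rule inj_onI) blast
  ultimately have "card (fam ` ?X) = card (?f ` ?X)" by (simp only: card_image)
  also have "\<dots> = (\<Prod>i=2..length ms. card (multisets_of_size {0..mu ms i} (num_cars ms i)))"
    using k by (simp add: exact_TPFs_eq[OF assms] profile_image mset_lists_below card_PiE)
  finally show ?thesis by (simp add: card_multisets_of_size)
qed

text \<open>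
  Each list contributes a multinomial coefficient. The product over \<open>0..\<mu>\<^sub>i\<close> in \<open>F\<close> may also run
  over values that do not occur in the list, whose factor is \<open>0! = 1\<close>.
\<close>

lemma card_fam:
  assumes "ms \<noteq> []" "\<alpha> \<in> exact_TPFs ms"
  shows "real (card (fam \<alpha>)) = F \<alpha>"
proof -
  have k: "1 \<le> length ms" using assms(1) by (cases ms) auto
  have order: "tpf_order \<alpha> = ms" using assms(2) by (simp add: exact_TPFs_def)
  have perms: "real (card (permutations_of_multiset (mset (prefs \<alpha> i)))) =
      fact (num_cars ms i) / (\<Prod>j=0..mu ms i. fact (count_list (prefs \<alpha> i) j))"
    if "i \<in> {2..length ms}" for i
  proof -
    let ?P = "mset (prefs \<alpha> i)"
    have P: "set (prefs \<alpha> i) \<subseteq> {0..mu ms i}" "length (prefs \<alpha> i) = num_cars ms i"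
      using assms(2) that by (auto simp: exact_TPFs_eq[OF assms(1)] tuples_def lists_below_def)
    have "(\<Prod>j=0..mu ms i. fact (count_list (prefs \<alpha> i) j)) = (\<Prod>j\<in>set_mset ?P. fact (count ?P j) :: nat)"
      using P(1) by (intro prod.mono_neutral_cong_right) (auto simp: count_mset)
    then have "card (permutations_of_multiset ?P) *
        (\<Prod>j=0..mu ms i. fact (count_list (prefs \<alpha> i) j)) = fact (num_cars ms i)"
      using card_permutations_of_multiset_aux[of ?P] P(2) by simp
    from arg_cong[OF this, of real]
    have "real (card (permutations_of_multiset ?P)) *
        (\<Prod>j=0..mu ms i. fact (count_list (prefs \<alpha> i) j)) = fact (num_cars ms i)"
      by simp
    then show ?thesis by (simp add: field_simps)
  qed
  have "real (card (fam \<alpha>)) =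
      (\<Prod>i=2..length ms. real (card (permutations_of_multiset (mset (prefs \<alpha> i)))))"
    using k by (simp add: fam_eq[OF assms] card_tuples)
  also have "\<dots> = (\<Prod>i=2..length ms.
      fact (num_cars ms i) / (\<Prod>j=0..mu ms i. fact (count_list (prefs \<alpha> i) j)))"
    by (intro prod.cong refl perms) simp
  also have "\<dots> = F \<alpha>"
    unfolding F_def order using k
    by (subst (2) prod.atLeast_Suc_atMost) (auto simp: numeral_2_eq_2 intro!: prod.cong)
  finally show ?thesis .
qed

theorem theorem5p9:
  fixes ms :: "nat list" and L :: nat
  assumes "ms \<noteq> []"
    and "\<forall>m\<in>set ms. 0 < m"
    and "L = (\<Prod>i=1..length ms. (\<Sum>j=1..i. num_cars ms j) choose num_cars ms i)"
  shows "card (fam ` exact_TPFs ms) = L \<and>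
    (\<forall>A :: nat \<Rightarrow> typed_tuple.
       (\<forall>j\<in>{1..L}. A j \<in> exact_TPFs ms) \<and>
       bij_betw (\<lambda>j. fam (A j)) {1..L} (fam ` exact_TPFs ms) \<longrightarrow>
       real (card (exact_TPFs ms)) = (\<Sum>j=1..L. F (A j)))"
proof (intro conjI allI impI)
  let ?X = "exact_TPFs ms"
  have k: "1 \<le> length ms" using assms(1) by (cases ms) auto
  have "(\<Sum>j=1..i. num_cars ms j) = mu ms i + num_cars ms i" if "1 \<le> i" for i
    using that by (simp add: mu_def sum.last_plus add.commute)
  then have "L = (\<Prod>i=1..length ms. (mu ms i + num_cars ms i) choose num_cars ms i)"
    unfolding assms(3) by (intro prod.cong) auto
  also have "\<dots> = (\<Prod>i=2..length ms. (mu ms i + num_cars ms i) choose num_cars ms i)"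
    using k by (subst prod.atLeast_Suc_atMost) (auto simp: numeral_2_eq_2 mu_def)
  finally show "card (fam ` ?X) = L" by (simp add: card_families[OF assms(1)])
  fix A :: "nat \<Rightarrow> typed_tuple"
  assume A: "(\<forall>j\<in>{1..L}. A j \<in> ?X) \<and> bij_betw (\<lambda>j. fam (A j)) {1..L} (fam ` ?X)"
  (* An infinite set would have cardinality 0, but F is positive. *)
  have "finite (fam \<alpha>)" if "\<alpha> \<in> ?X" for \<alpha>
  proof -
    have "0 < F \<alpha>" unfolding F_def by (intro prod_pos) (auto intro!: divide_pos_pos prod_pos)
    then show ?thesis using card_fam[OF assms(1) that] card_ge_0_finite by force
  qed
  moreover have "pairwise disjnt (fam ` ?X)"
    by (auto simp: pairwise_def disjnt_def fam_eq_same_profile[OF assms(1)])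
  ultimately have "card (\<Union>(fam ` ?X)) = sum card (fam ` ?X)"
    by (intro card_Union_disjoint) auto
  moreover have "\<Union>(fam ` ?X) = ?X"
    by (auto simp: fam_eq_same_profile[OF assms(1)])
  ultimately have "card ?X = sum card (fam ` ?X)" by simp
  also have "\<dots> = (\<Sum>j=1..L. card (fam (A j)))"
    using A by (intro sum.reindex_bij_betw[symmetric]) auto
  finally have "real (card ?X) = (\<Sum>j=1..L. real (card (fam (A j))))" by simp
  then show "real (card ?X) = (\<Sum>j=1..L. F (A j))"
    using A by (simp add: card_fam[OF assms(1)])
qed

end
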